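(* Let $\mathscr{A}$ be a complex Banach algebra with unity $1$, let $\lambda\in\mathbb{C}$ with $\lambda\neq 0$, and let $a,b\in\mathscr{A}$ be p-Drazin invertible with $ab=\lambda ba$. Put $w=aa^{\ddagger}(a-b)bb^{\ddagger}$. Then $a-b$ is p-Drazin invertible if and only if $w$ is p-Drazin invertible. In this case, $$(a-b)^{\ddagger}=w^{\ddagger}+\sum_{i=0}^{\infty}a^{\ddagger}(ba^{\ddagger})^{i}b^{\Pi}-\sum_{i=0}^{\infty}a^{\Pi}(b^{\ddagger}a)^{i}b^{\ddagger},$$ and $$w^{\ddagger}=aa^{\ddagger}(a-b)^{\ddagger}bb^{\ddagger}.$$
   Context: $J(\mathscr{A})$ denotes the Jacobson radical of $\mathscr{A}$. An element $a\in\mathscr{A}$ is called pseudo Drazin invertible (p-Drazin invertible) if there exists $x\in\mathscr{A}$ such that $ax=xa$, $xax=x$, and $a^{k}-a^{k+1}x\in J(\mathscr{A})$ for some integer $k\geqslant 1$. Such an $x$ is unique when it exists; it is called the p-Drazin inverse of $a$ and is denoted by $a^{\ddagger}$. For a p-Drazin invertible element $a$, $a^{\Pi}=1-aa^{\ddagger}$ (and similarly $b^{\Pi}=1-bb^{\ddagger}$). The zeroth power of any element is $1$, and infinite series converge in the norm of $\mathscr{A}$. *)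

theory Defs
  imports "HOL-Analysis.Analysis"
begin

text \<open>
  Complex Banach algebras with unity. The real structure underlying \<^class>\<open>banach\<close> is tied to the
  complex one by \<open>scaleR_scaleC\<close>. The unity is nonzero (by \<^class>\<open>real_algebra_1\<close>), but
  \<open>norm 1 = 1\<close> is not required; algebras satisfying it are included.
\<close>

class complex_banach_algebra = real_normed_algebra + real_algebra_1 + banach +
  fixes scaleC :: "complex \<Rightarrow> 'a \<Rightarrow> 'a"  (infixr \<open>*\<^sub>C\<close> 75)
  assumes scaleC_add_right: "c *\<^sub>C (x + y) = c *\<^sub>C x + c *\<^sub>C y"
    and scaleC_add_left: "(c + d) *\<^sub>C x = c *\<^sub>C x + d *\<^sub>C x"
    and scaleC_scaleC: "c *\<^sub>C d *\<^sub>C x = (c * d) *\<^sub>C x"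
    and scaleC_one: "1 *\<^sub>C x = x"
    and scaleR_scaleC: "scaleR r x = complex_of_real r *\<^sub>C x"
    and mult_scaleC_left: "(c *\<^sub>C x) * y = c *\<^sub>C (x * y)"
    and mult_scaleC_right: "x * (c *\<^sub>C y) = c *\<^sub>C (x * y)"
    and norm_scaleC: "norm (c *\<^sub>C x) = cmod c * norm x"

definition left_ideal :: "'a::ring_1 set \<Rightarrow> bool" where
  "left_ideal I \<longleftrightarrow> 0 \<in> I \<and> (\<forall>x\<in>I. \<forall>y\<in>I. x + y \<in> I) \<and> (\<forall>r. \<forall>x\<in>I. r * x \<in> I)"

definition maximal_left_ideal :: "'a::ring_1 set \<Rightarrow> bool" where
  "maximal_left_ideal M \<longleftrightarrow> left_ideal M \<and> M \<noteq> UNIV \<and>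
     (\<forall>I. left_ideal I \<longrightarrow> M \<subseteq> I \<longrightarrow> I = M \<or> I = UNIV)"

definition jacobson_radical :: "'a::ring_1 set" where
  "jacobson_radical = \<Inter> {M. maximal_left_ideal M}"

definition is_pDrazin_inverse :: "'a::ring_1 \<Rightarrow> 'a \<Rightarrow> bool" where
  "is_pDrazin_inverse a x \<longleftrightarrow> a * x = x * a \<and> x * a * x = x \<and>
     (\<exists>k\<ge>1. a ^ k - a ^ (k + 1) * x \<in> jacobson_radical)"

definition pDrazin_invertible :: "'a::ring_1 \<Rightarrow> bool" where
  "pDrazin_invertible a \<longleftrightarrow> (\<exists>x. is_pDrazin_inverse a x)"

text \<open>Meaningful only for p-Drazin invertible \<open>a\<close>, for which the inverse is unique.\<close>

definition pDrazin_inverse :: "'a::ring_1 \<Rightarrow> 'a"  (\<open>_\<^sup>\<ddagger>\<close> [1000] 999) where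
  "a\<^sup>\<ddagger> = (THE x. is_pDrazin_inverse a x)"

definition pDrazin_idempotent :: "'a::ring_1 \<Rightarrow> 'a"  (\<open>_\<^sup>\<Pi>\<close> [1000] 999) where
  "a\<^sup>\<Pi> = 1 - a * a\<^sup>\<ddagger>"

end

theory Submission
  imports Defs
begin

text \<open>
  Since some power of \<open>a a\<^sup>\<Pi>\<close> lies in the radical, \<open>a a\<^sup>\<Pi>\<close> is quasinilpotent, so
  \<open>ab = \<mu> ba\<close> forces the off-diagonal corners of \<open>b\<close> with respect to \<open>P = a a\<^sup>\<ddagger>\<close> to vanish. Hence
  \<open>P\<close> and \<open>Q = b b\<^sup>\<ddagger>\<close> commute with each other and with \<open>a\<close> and \<open>b\<close>, and \<open>a - b\<close> splits into four
  blocks. On \<open>PQ\<close> it is \<open>w\<close>; on \<open>P(1 - Q)\<close> and \<open>(1 - P)Q\<close> it is a quasinilpotent perturbation of an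
  invertible element, inverted by the two Neumann series; on \<open>(1 - P)(1 - Q)\<close> some power of it lies
  in the radical.
\<close>

section \<open>The Jacobson radical\<close>

lemma left_idealD:
  assumes "left_ideal I"
  shows "0 \<in> I" "x \<in> I \<Longrightarrow> y \<in> I \<Longrightarrow> x + y \<in> I" "x \<in> I \<Longrightarrow> r * x \<in> I"
  using assms by (auto simp: left_ideal_def)

lemma left_ideal_eq_UNIV_iff:
  assumes "left_ideal I"
  shows "I = UNIV \<longleftrightarrow> 1 \<in> I"
  using left_idealD(3)[OF assms, of 1] by auto

lemma left_ideal_principal: "left_ideal (range (\<lambda>r. r * x))"
  unfolding left_ideal_def
proof (intro conjI ballI allI)
  show "0 \<in> range (\<lambda>r. r * x)" by (rule range_eqI[of _ _ 0]) simp
next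
  fix u v assume "u \<in> range (\<lambda>r. r * x)" "v \<in> range (\<lambda>r. r * x)"
  then obtain r s where "u = r * x" "v = s * x" by auto
  then show "u + v \<in> range (\<lambda>r. r * x)"
    by (intro range_eqI[of _ _ "r + s"]) (simp add: algebra_simps)
next
  fix r u assume "u \<in> range (\<lambda>r. r * x)"
  then obtain s where "u = s * x" by auto
  then show "r * u \<in> range (\<lambda>r. r * x)"
    by (intro range_eqI[of _ _ "r * s"]) (simp add: algebra_simps)
qed

lemma left_ideal_sum:
  assumes "left_ideal I" "left_ideal K"
  shows "left_ideal {x + y | x y. x \<in> I \<and> y \<in> K}"
  unfolding left_ideal_def
proof (intro conjI ballI allI)
  show "0 \<in> {x + y | x y. x \<in> I \<and> y \<in> K}"
    using left_idealD(1)[OF assms(1)] left_idealD(1)[OF assms(2)] by force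
next
  fix u v assume "u \<in> {x + y | x y. x \<in> I \<and> y \<in> K}" "v \<in> {x + y | x y. x \<in> I \<and> y \<in> K}"
  then obtain x y x' y' where "u = x + y" "v = x' + y'" and
    mem: "x \<in> I" "y \<in> K" "x' \<in> I" "y' \<in> K" by auto
  then have "u + v = (x + x') + (y + y')" by simp
  with mem left_idealD(2)[OF assms(1)] left_idealD(2)[OF assms(2)]
  show "u + v \<in> {x + y | x y. x \<in> I \<and> y \<in> K}" by blast
next
  fix r u assume "u \<in> {x + y | x y. x \<in> I \<and> y \<in> K}"
  then obtain x y where "u = x + y" "x \<in> I" "y \<in> K" by auto
  then have "r * u = r * x + r * y" "r * x \<in> I" "r * y \<in> K"
    using left_idealD(3)[OF assms(1)] left_idealD(3)[OF assms(2)] by (auto simp: distrib_left)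
  then show "r * u \<in> {x + y | x y. x \<in> I \<and> y \<in> K}" by blast
qed

text \<open>Zorn's lemma. Properness is expressed as \<open>1 \<notin> K\<close>, which visibly
  passes to unions of chains.\<close>

lemma ex_maximal_left_ideal:
  assumes I: "left_ideal I" "1 \<notin> I"
  obtains M where "maximal_left_ideal M" "I \<subseteq> M"
proof -
  define A where "A = {K. left_ideal K \<and> 1 \<notin> K \<and> I \<subseteq> K}"
  have "A \<noteq> {}" using I by (auto simp: A_def)
  moreover have "\<Union>C \<in> A" if C: "C \<noteq> {}" "subset.chain A C" for C
  proof -
    have CA: "C \<subseteq> A" and tot: "\<And>K L. K \<in> C \<Longrightarrow> L \<in> C \<Longrightarrow> K \<subseteq> L \<or> L \<subseteq> K"
      using C(2) by (auto simp: subset_chain_def)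
    have ideal: "\<And>K. K \<in> C \<Longrightarrow> left_ideal K" using CA by (auto simp: A_def)
    have "left_ideal (\<Union>C)"
      unfolding left_ideal_def
    proof (intro conjI ballI allI)
      show "0 \<in> \<Union>C" using C(1) ideal left_idealD(1) by blast
    next
      fix x y assume "x \<in> \<Union>C" "y \<in> \<Union>C"
      then obtain K where "K \<in> C" "x \<in> K" "y \<in> K" using tot by blast
      then show "x + y \<in> \<Union>C" using ideal left_idealD(2) by blast
    next
      fix r x assume "x \<in> \<Union>C"
      then show "r * x \<in> \<Union>C" using ideal left_idealD(3) by blast
    qed
    then show ?thesis using C(1) CA by (auto simp: A_def)
  qed
  ultimately obtain M where M: "M \<in> A" and max: "\<And>K. K \<in> A \<Longrightarrow> M \<subseteq> K \<Longrightarrow> K = M"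
    using subset_Zorn_nonempty[of A] by blast
  have "maximal_left_ideal M"
    unfolding maximal_left_ideal_def
  proof (intro conjI allI impI)
    show "left_ideal M" "M \<noteq> UNIV" using M by (auto simp: A_def)
    fix K assume K: "left_ideal K" "M \<subseteq> K"
    show "K = M \<or> K = UNIV"
    proof (cases "1 \<in> K")
      case True
      then show ?thesis using K left_ideal_eq_UNIV_iff by blast
    next
      case False
      then have "K \<in> A" using K M by (auto simp: A_def)
      then show ?thesis using max K by blast
    qed
  qed
  then show ?thesis using that M by (auto simp: A_def)
qed

text \<open>If \<open>1 - x * j\<close> has no left inverse, it generates a proper left ideal; a
  maximal one above it contains \<open>x * j\<close> too, hence 1. Conversely, if \<open>j\<close>
  lies outside a maximal \<open>M\<close>, then \<open>M\<close> together with the multiples of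
  \<open>j\<close> spans everything, so some \<open>1 - x * j\<close> lies in \<open>M\<close> and
  cannot be left invertible.\<close>

lemma jacobson_radical_iff:
  "j \<in> jacobson_radical \<longleftrightarrow> (\<forall>x. \<exists>y. y * (1 - x * j) = 1)"
proof
  assume j: "j \<in> jacobson_radical"
  show "\<forall>x. \<exists>y. y * (1 - x * j) = 1"
  proof (rule allI, rule ccontr)
    fix x assume no: "\<nexists>y. y * (1 - x * j) = 1"
    let ?I = "range (\<lambda>r. r * (1 - x * j))"
    have "1 \<notin> ?I" using no by (metis imageE)
    then obtain M where M: "maximal_left_ideal M" "?I \<subseteq> M"
      using ex_maximal_left_ideal[OF left_ideal_principal] by blast
    then have lM: "left_ideal M" "M \<noteq> UNIV" by (auto simp: maximal_left_ideal_def)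
    have "1 * (1 - x * j) \<in> M" using M(2) by blast
    moreover have "x * j \<in> M"
      using j M(1) left_idealD(3)[OF lM(1)] by (auto simp: jacobson_radical_def)
    ultimately have "1 * (1 - x * j) + x * j \<in> M" by (rule left_idealD(2)[OF lM(1)])
    then show False using left_ideal_eq_UNIV_iff[OF lM(1)] lM(2) by simp
  qed
next
  assume inv: "\<forall>x. \<exists>y. y * (1 - x * j) = 1"
  show "j \<in> jacobson_radical"
    unfolding jacobson_radical_def
  proof (rule InterI, rule ccontr, clarify)
    fix M assume M: "maximal_left_ideal M" "j \<notin> M"
    then have lM: "left_ideal M" "M \<noteq> UNIV"
      and max: "\<And>K. left_ideal K \<Longrightarrow> M \<subseteq> K \<Longrightarrow> K = M \<or> K = UNIV"
      by (auto simp: maximal_left_ideal_def)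
    let ?K = "{x + y | x y. x \<in> M \<and> y \<in> range (\<lambda>r. r * j)}"
    have lK: "left_ideal ?K" by (rule left_ideal_sum[OF lM(1) left_ideal_principal])
    have "M \<subseteq> ?K"
    proof
      fix m assume "m \<in> M"
      moreover have "m = m + 0 * j" by simp
      ultimately show "m \<in> ?K" by blast
    qed
    moreover have "j \<in> ?K"
    proof -
      have "j = 0 + 1 * j" by simp
      then show ?thesis using left_idealD(1)[OF lM(1)] by blast
    qed
    ultimately have "?K = UNIV" using max[OF lK] M(2) by blast
    then have "1 \<in> ?K" by blast
    then obtain m x where m: "1 = m + x * j" "m \<in> M" by blast
    obtain y where y: "y * (1 - x * j) = 1" using inv by blast
    have "m = 1 - x * j" using m(1) by (simp add: algebra_simps)
    then have "y * m = 1" using y by simp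
    then have "1 \<in> M" using left_idealD(3)[OF lM(1) m(2), of y] by simp
    then show False using left_ideal_eq_UNIV_iff[OF lM(1)] lM(2) by simp
  qed
qed

text \<open>A left inverse \<open>y\<close> of \<open>1 - x * j\<close> equals
  \<open>1 + y * x * j\<close>, again of the form covered by the criterion. So \<open>y\<close> has
  a left inverse as well, which must be \<open>1 - x * j\<close>.\<close>

lemma jacobson_radical_inverse:
  assumes "j \<in> jacobson_radical"
  obtains y where "y * (1 - x * j) = 1" "(1 - x * j) * y = 1"
proof -
  obtain y where y: "y * (1 - x * j) = 1" using assms jacobson_radical_iff by blast
  obtain z where z: "z * (1 - (- (y * x)) * j) = 1" using assms jacobson_radical_iff by blast
  have "1 - (- (y * x)) * j = y" using y by (simp add: algebra_simps)
  then have zy: "z * y = 1" using z by simp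
  have "z = z * (y * (1 - x * j))" using y by simp
  also have "\<dots> = 1 - x * j" using zy by (simp add: mult.assoc[symmetric])
  finally have "(1 - x * j) * y = 1" using zy by simp
  then show ?thesis using that y by blast
qed

lemma left_ideal_jacobson_radical: "left_ideal jacobson_radical"
  unfolding left_ideal_def jacobson_radical_def maximal_left_ideal_def by auto

lemmas jacobson_radical_add = left_idealD(2)[OF left_ideal_jacobson_radical]
lemmas jacobson_radical_mult_left = left_idealD(3)[OF left_ideal_jacobson_radical]

lemma jacobson_radical_diff:
  "x \<in> jacobson_radical \<Longrightarrow> y \<in> jacobson_radical \<Longrightarrow> x - y \<in> jacobson_radical"
  using jacobson_radical_add[of x "(-1) * y"] jacobson_radical_mult_left[of y "-1"] by simp

text \<open>The radical is built from left ideals, so this side needs an argument: if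
  \<open>c\<close> inverts \<open>1 - r * x * j\<close> on the left, then
  \<open>1 + x * j * c * r\<close> inverts \<open>1 - x * j * r\<close> on the left.\<close>

lemma jacobson_radical_mult_right:
  assumes "j \<in> jacobson_radical"
  shows "j * r \<in> jacobson_radical"
  unfolding jacobson_radical_iff
proof
  fix x
  obtain c where c: "c * (1 - r * x * j) = 1"
    using jacobson_radical_inverse[OF assms, of "r * x"] by auto
  have "(1 + x * j * c * r) * (1 - x * j * r) = 1 - x * j * r + x * j * (c * (1 - r * x * j)) * r"
    by (simp add: algebra_simps)
  also have "\<dots> = 1" by (simp add: c)
  finally show "\<exists>y. y * (1 - x * (j * r)) = 1" by (auto simp: mult.assoc)
qed

text \<open>\<open>1 - e\<close> is invertible and annihilates \<open>e\<close>.\<close>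

lemma idempotent_in_jacobson_radical:
  assumes "e * e = e" "e \<in> jacobson_radical"
  shows "e = 0"
proof -
  obtain y where "y * (1 - e) = 1" using jacobson_radical_inverse[OF assms(2), of 1] by auto
  then have "e = y * (1 - e) * e" by simp
  also have "\<dots> = 0" using assms(1) by (simp add: mult.assoc left_diff_distrib)
  finally show ?thesis .
qed

section \<open>Quasinilpotent elements\<close>

lemma scaleC_zero_left [simp]: "0 *\<^sub>C (x::'a::complex_banach_algebra) = 0"
  using scaleC_add_left[of 0 0 x] by simp

lemma scaleC_minus_left: "(- c) *\<^sub>C (x::'a::complex_banach_algebra) = - (c *\<^sub>C x)"
  using scaleC_add_left[of c "-c" x] by (simp add: eq_neg_iff_add_eq_0 add.commute)

lemma scaleC_diff_left: "(c - d) *\<^sub>C (x::'a::complex_banach_algebra) = c *\<^sub>C x - d *\<^sub>C x"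
  using scaleC_add_left[of c "-d" x] by (simp add: scaleC_minus_left)

lemma scaleC_sum_left:
  "(\<Sum>i\<in>A. f i) *\<^sub>C (x::'a::complex_banach_algebra) = (\<Sum>i\<in>A. f i *\<^sub>C x)"
  by (induction A rule: infinite_finite_induct) (simp_all add: scaleC_add_left)

lemma scaleC_power: "(c *\<^sub>C (x::'a::complex_banach_algebra)) ^ n = c ^ n *\<^sub>C x ^ n"
  by (induction n) (simp_all add: scaleC_one mult_scaleC_left mult_scaleC_right scaleC_scaleC
      power_commutes)

lemma scaleC_eq_mult: "c *\<^sub>C (x::'a::complex_banach_algebra) = (c *\<^sub>C 1) * x"
  by (simp add: mult_scaleC_left)

lemma jacobson_radical_scaleC:
  "(x::'a::complex_banach_algebra) \<in> jacobson_radical \<Longrightarrow> c *\<^sub>C x \<in> jacobson_radical"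
  by (subst scaleC_eq_mult) (rule jacobson_radical_mult_left)

text \<open>The spectrum is contained in {0}. Inverting \<open>1 - z *\<^sub>C s\<close> instead of
  the scalar minus \<open>s\<close> makes the resolvent total in \<open>z\<close>.\<close>

definition quasinilpotent :: "'a::complex_banach_algebra \<Rightarrow> bool" where
  "quasinilpotent s \<longleftrightarrow> (\<forall>z. \<exists>y. y * (1 - z *\<^sub>C s) = 1 \<and> (1 - z *\<^sub>C s) * y = 1)"

lemma one_diff_power_factor:
  "(1 - x) * (\<Sum>i<n. x ^ i) = 1 - x ^ n" "(\<Sum>i<n. x ^ i) * (1 - x) = 1 - (x::'a::ring_1) ^ n"
proof (induction n)
  case (Suc n)
  { case 1
    show ?case by (simp add: distrib_left Suc.IH left_diff_distrib[of 1 x "x ^ n"]) }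
  { case 2
    show ?case by (simp add: distrib_right Suc.IH right_diff_distrib[of "x ^ n"] power_commutes) }
qed simp_all

text \<open>\<open>1 - (z *\<^sub>C s) ^ k\<close> is invertible by the radical criterion, and
  \<open>1 - z *\<^sub>C s\<close> divides it on either side with the geometric sum as cofactor. The
  resulting left and right inverses agree.\<close>

lemma quasinilpotent_of_power_in_jacobson_radical:
  assumes "s ^ k \<in> jacobson_radical"
  shows "quasinilpotent s"
  unfolding quasinilpotent_def
proof
  fix z
  let ?x = "z *\<^sub>C s" and ?G = "\<Sum>i<k. (z *\<^sub>C s) ^ i"
  obtain y where y: "y * (1 - (z ^ k *\<^sub>C 1) * s ^ k) = 1" "(1 - (z ^ k *\<^sub>C 1) * s ^ k) * y = 1"
    using jacobson_radical_inverse[OF assms] by blast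
  have e: "(z ^ k *\<^sub>C 1) * s ^ k = ?x ^ k" by (simp add: scaleC_power mult_scaleC_left)
  have l: "(y * ?G) * (1 - ?x) = 1"
    using y(1) by (simp add: mult.assoc one_diff_power_factor e)
  have r: "(1 - ?x) * (?G * y) = 1"
    using y(2) by (simp add: mult.assoc[symmetric] one_diff_power_factor e)
  have "y * ?G = (y * ?G) * ((1 - ?x) * (?G * y))" using r by simp
  also have "\<dots> = ?G * y" using l by (simp add: mult.assoc[symmetric])
  finally show "\<exists>y. y * (1 - z *\<^sub>C s) = 1 \<and> (1 - z *\<^sub>C s) * y = 1"
    using l r by auto
qed

section \<open>Decay of powers of quasinilpotent elements, by averaging over roots of unity\<close>

lemma sum_powers_cis:
  assumes "m < n"
  shows "(\<Sum>k<n. (cis (2 * pi / n) ^ k) ^ m) = (if m = 0 then of_nat n else 0)"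
proof (cases "m = 0")
  case False
  let ?\<omega> = "cis (2 * pi / n) ^ m"
  have "?\<omega> = cis (2 * pi * m / n)" by (subst Complex.DeMoivre) (simp add: field_simps)
  moreover have "cis (2 * pi * m / n) \<noteq> 1"
  proof
    assume "cis (2 * pi * m / n) = 1"
    then have "cos (2 * pi * m / n) = 1" by (simp add: complex_eq_iff)
    then obtain i :: int where "2 * pi * m / n = i * (2 * pi)" 
      using cos_one_2pi_int by auto
    then have "real m = i * real n" using assms by (simp add: field_simps)
    then have "real_of_int (int m) = real_of_int (i * int n)" by simp
    then have "int m = i * int n" by (simp only: of_int_eq_iff)
    then have "int n dvd int m" by simp
    then have "n dvd m" by simp
    then show False using assms False by (auto dest: dvd_imp_le)
  qed
  moreover have "?\<omega> ^ n = 1"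
  proof -
    have "cis (2 * pi / n) ^ n = 1" using assms by (simp add: Complex.DeMoivre)
    then show ?thesis by (simp add: power_mult[symmetric] mult.commute[of m] power_mult[of _ n m])
  qed
  ultimately have "(\<Sum>k<n. ?\<omega> ^ k) = 0" using geometric_sum[of ?\<omega> n] by simp
  then show ?thesis using False by (simp add: power_mult[symmetric] mult.commute)
qed simp

text \<open>The factor \<open>y\<close> covers \<open>n = 0\<close>: as \<open>norm 1 = 1\<close> is
  not assumed, \<open>norm (p ^ n)\<close> need not be bounded by \<open>norm p ^ n\<close>
  there.\<close>

lemma norm_power_mult_le:
  fixes p y :: "'a::{real_normed_algebra,ring_1}"
  shows "norm (p ^ n * y) \<le> norm p ^ n * norm y"
proof (induction n)
  case (Suc n)
  have "norm (p ^ Suc n * y) \<le> norm p * norm (p ^ n * y)"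
    by (simp add: mult.assoc norm_mult_ineq)
  also have "\<dots> \<le> norm p * (norm p ^ n * norm y)"
    using Suc by (intro mult_left_mono) auto
  finally show ?case by (simp add: mult.assoc)
qed simp

text \<open>The mean of the resolvents at \<open>\<omega>\<^sup>k z\<close> is the inverse of \<open>1 - (zs)\<^sup>n\<close>; this replaces the
  Cauchy integral in the spectral radius formula.\<close>

lemma resolvent_average:
  fixes s :: "'a::complex_banach_algebra"
  assumes f: "\<And>z. f z * (1 - z *\<^sub>C s) = 1" "\<And>z. (1 - z *\<^sub>C s) * f z = 1" and "n > 0"
  shows "(1 - z ^ n *\<^sub>C s ^ n) * (\<Sum>k<n. f (cis (2 * pi / n) ^ k * z)) = of_nat n"
proof -
  let ?\<omega> = "cis (2 * pi / n)"
  \<comment> \<open>Rotating \<open>z\<close> by an n-th root of unity preserves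
    \<open>z ^ n\<close>, so one factor \<open>1 - z ^ n *\<^sub>C s ^ n\<close> turns every summand
    into a finite geometric sum.\<close>
  have [simp]: "(?\<omega> ^ k) ^ n = 1" for k
  proof -
    have "?\<omega> ^ n = 1" using assms(3) by (simp add: Complex.DeMoivre)
    then show ?thesis by (simp add: power_mult[symmetric] mult.commute[of k] power_mult[of _ n k])
  qed
  have "(1 - z ^ n *\<^sub>C s ^ n) * f (?\<omega> ^ k * z)
    = (\<Sum>m<n. (?\<omega> ^ k) ^ m *\<^sub>C (z ^ m *\<^sub>C s ^ m))" for k
  proof -
    have "1 - z ^ n *\<^sub>C s ^ n = 1 - ((?\<omega> ^ k * z) *\<^sub>C s) ^ n"
      by (simp add: scaleC_power power_mult_distrib)
    also have "\<dots> = (\<Sum>m<n. ((?\<omega> ^ k * z) *\<^sub>C s) ^ m) * (1 - (?\<omega> ^ k * z) *\<^sub>C s)"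
      by (simp add: one_diff_power_factor)
    finally have "(1 - z ^ n *\<^sub>C s ^ n) * f (?\<omega> ^ k * z) = (\<Sum>m<n. ((?\<omega> ^ k * z) *\<^sub>C s) ^ m)"
      by (simp add: mult.assoc f)
    then show ?thesis by (simp add: scaleC_power power_mult_distrib scaleC_scaleC)
  qed
  then have "(1 - z ^ n *\<^sub>C s ^ n) * (\<Sum>k<n. f (?\<omega> ^ k * z))
    = (\<Sum>k<n. \<Sum>m<n. (?\<omega> ^ k) ^ m *\<^sub>C (z ^ m *\<^sub>C s ^ m))"
    by (simp add: sum_distrib_left)
  \<comment> \<open>After the swap, orthogonality of the roots of unity leaves only
    \<open>m = 0\<close>.\<close>
  also have "\<dots> = (\<Sum>m<n. (\<Sum>k<n. (?\<omega> ^ k) ^ m) *\<^sub>C (z ^ m *\<^sub>C s ^ m))"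
    by (subst sum.swap) (simp add: scaleC_sum_left)
  also have "\<dots> = (\<Sum>m<n. if m = 0 then of_nat n *\<^sub>C 1 else 0)"
    by (intro sum.cong refl) (simp add: sum_powers_cis scaleC_one)
  also have "\<dots> = of_nat n *\<^sub>C 1" using assms(3) by simp
  also have "\<dots> = of_nat n"
    using scaleR_scaleC[of "real n" "1::'a"] by (simp add: scaleR_conv_of_real)
  finally show ?thesis .
qed

text \<open>The resolvent identity \<open>f z - f w = (z - w) *\<^sub>C (f z * (s * f w))\<close>
  gives continuity once \<open>f\<close> is known to be bounded near \<open>w\<close>.\<close>

lemma resolvent_continuous:
  fixes s :: "'a::complex_banach_algebra"
  assumes f: "\<And>z. f z * (1 - z *\<^sub>C s) = 1" "\<And>z. (1 - z *\<^sub>C s) * f z = 1"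
  shows "isCont f w"
proof -
  have diff: "norm (f z - f w) \<le> cmod (z - w) * (norm (f z) * (norm s * norm (f w)))" for z
  proof -
    have "f z - f w = f z * ((1 - w *\<^sub>C s) * f w) - (f z * (1 - z *\<^sub>C s)) * f w"
      by (simp add: f)
    also have "\<dots> = f z * ((1 - w *\<^sub>C s) - (1 - z *\<^sub>C s)) * f w"
      by (simp only: left_diff_distrib right_diff_distrib mult.assoc)
    also have "\<dots> = f z * ((z - w) *\<^sub>C s) * f w"
      by (simp add: scaleC_diff_left)
    also have "\<dots> = (z - w) *\<^sub>C (f z * (s * f w))"
      by (simp add: mult_scaleC_left mult_scaleC_right mult.assoc)
    finally have "norm (f z - f w) = cmod (z - w) * norm (f z * (s * f w))"
      by (simp add: norm_scaleC)
    also have "\<dots> \<le> cmod (z - w) * (norm (f z) * (norm s * norm (f w)))"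
      by (intro mult_left_mono order_trans[OF norm_mult_ineq] mult_left_mono norm_mult_ineq) auto
    finally show ?thesis .
  qed
  define K where "K = norm s * norm (f w)"
  have K: "K \<ge> 0" by (simp add: K_def)
  \<comment> \<open>The bound in \<open>diff\<close> contains \<open>norm (f z)\<close> itself.
    Where \<open>cmod (z - w) * K < 1/2\<close> this term is absorbed, giving
    \<open>norm (f z) \<le> 2 * norm (f w)\<close>.\<close>
  have ev: "\<forall>\<^sub>F z in at w. norm (f z - f w) \<le> cmod (z - w) * (2 * norm (f w) * K)"
  proof -
    have "((\<lambda>z. cmod (z - w) * K) \<longlongrightarrow> 0) (at w)"
      by (auto intro!: tendsto_eq_intros)
    then have "\<forall>\<^sub>F z in at w. cmod (z - w) * K < 1/2"
      by (rule order_tendstoD) simp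
    then show ?thesis
    proof eventually_elim
      case (elim z)
      have "norm (f z) \<le> norm (f w) + norm (f z - f w)"
        by (metis add.commute diff_add_cancel norm_triangle_ineq)
      also have "\<dots> \<le> norm (f w) + (cmod (z - w) * K) * norm (f z)"
        using diff[of z] by (simp add: K_def algebra_simps)
      also have "\<dots> \<le> norm (f w) + 1/2 * norm (f z)"
        using elim by (intro add_left_mono mult_right_mono) auto
      finally have "norm (f z) \<le> 2 * norm (f w)" by simp
      then have "cmod (z - w) * (norm (f z) * K) \<le> cmod (z - w) * (2 * norm (f w) * K)"
        using K by (intro mult_left_mono mult_right_mono) auto
      then show ?case using diff[of z] by (simp add: K_def)
    qed
  qed
  have "((\<lambda>z. cmod (z - w) * (2 * norm (f w) * K)) \<longlongrightarrow> 0) (at w)"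
    by (auto intro!: tendsto_eq_intros)
  then have "((\<lambda>z. f z - f w) \<longlongrightarrow> 0) (at w)"
    by (rule Lim_null_comparison[OF ev])
  then show ?thesis by (simp add: isCont_def LIM_zero_cancel)
qed

text \<open>From \<open>u = (u - 1) * (1 - F)\<close>, half of \<open>norm u\<close> is absorbed on
  the left. This turns nearness of the averaged resolvent to 1 into a bound on a power of
  \<open>s\<close>.\<close>

lemma norm_le_of_inverse_near_one:
  fixes u F :: "'a::{real_normed_algebra,ring_1}"
  assumes "(1 - u) * F = 1" "norm (F - 1) \<le> 1/2"
  shows "norm u \<le> norm (1::'a)"
proof -
  have "u = (u - 1) * (1 - F)" using assms(1) by (simp add: algebra_simps)
  then have "norm u \<le> norm (u - 1) * norm (1 - F)" by (metis norm_mult_ineq)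
  also have "\<dots> \<le> (norm u + norm (1::'a)) * (1/2)"
    using assms(2) by (intro mult_mono norm_triangle_ineq4) (auto simp: norm_minus_commute)
  finally show ?thesis by simp
qed

text \<open>The opposite passage: \<open>F - 1 = u + u * (F - 1)\<close>, and absorbing the last
  term costs the factor \<open>5/4 = 1 / (1 - 1/5)\<close>.\<close>

lemma inverse_near_one:
  fixes u F :: "'a::{real_normed_algebra,ring_1}"
  assumes "(1 - u) * F = 1" "norm u \<le> 1/5"
  shows "norm (F - 1) \<le> norm u * norm (1::'a) * (5/4)"
proof -
  have "F - 1 = u * 1 + u * (F - 1)" using assms(1) by (simp add: algebra_simps)
  then have "norm (F - 1) \<le> norm u * norm (1::'a) + norm u * norm (F - 1)"
    by (metis add_mono norm_mult_ineq norm_triangle_le)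
  also have "norm u * norm (F - 1) \<le> 1/5 * norm (F - 1)"
    using assms(2) by (intro mult_right_mono) auto
  finally show ?thesis by simp
qed

text \<open>By uniform continuity of the averaged resolvents, convergence of \<open>(ts)\<^sup>n\<close> to \<open>0\<close>
  propagates from \<open>t\<close> to \<open>t + \<delta>/2\<close> with \<open>\<delta>\<close> uniform on bounded intervals.\<close>

lemma quasinilpotent_powers_tendsto_0:
  fixes s :: "'a::complex_banach_algebra"
  assumes "quasinilpotent s" "t \<ge> 0"
  shows "(\<lambda>n. t ^ n * norm (s ^ n)) \<longlonglongrightarrow> 0"
proof -
  \<comment> \<open>The margin leaves room inside the disc for a radius strictly larger than
    \<open>t\<close>.\<close>
  define R where "R = t + 1"
  obtain f where f: "\<And>z. f z * (1 - z *\<^sub>C s) = 1" "\<And>z. (1 - z *\<^sub>C s) * f z = 1"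
    using assms(1) unfolding quasinilpotent_def by metis
  have "continuous_on (cball 0 R) f"
    using resolvent_continuous[OF f] by (intro continuous_at_imp_continuous_on) auto
  then have "uniformly_continuous_on (cball 0 R) f"
    by (intro compact_uniformly_continuous) auto
  then obtain \<delta> where \<delta>: "\<delta> > 0" and uc:
    "\<And>z z'. z \<in> cball 0 R \<Longrightarrow> z' \<in> cball 0 R \<Longrightarrow> dist z' z < \<delta> \<Longrightarrow> dist (f z') (f z) < 1/4"
    unfolding uniformly_continuous_on_def
    by (metis zero_less_divide_1_iff zero_less_numeral)
  define F where "F n z = (1 / real n) *\<^sub>R (\<Sum>k<n. f (cis (2 * pi / n) ^ k * z))" for n z
  have F_inv: "(1 - z ^ n *\<^sub>C s ^ n) * F n z = 1" if "n > 0" for n z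
  proof -
    have "(of_nat n :: 'a) = real n *\<^sub>R 1" by (simp add: scaleR_conv_of_real)
    then show ?thesis using that by (simp add: F_def resolvent_average[OF f that])
  qed
  \<comment> \<open>Rotations preserve moduli and distances, so the same \<open>\<delta>\<close>
    serves the averages for every \<open>n\<close>.\<close>
  have F_near: "norm (F n z' - F n z) \<le> 1/4"
    if "n > 0" "cmod z \<le> R" "cmod z' \<le> R" "dist z' z < \<delta>" for n z z'
  proof -
    let ?\<omega> = "cis (2 * pi / n)"
    have "norm (\<Sum>k<n. f (?\<omega> ^ k * z') - f (?\<omega> ^ k * z)) \<le> (\<Sum>k<n. 1/4)"
    proof (rule sum_norm_le)
      fix k
      have "dist (?\<omega> ^ k * z') (?\<omega> ^ k * z) = dist z' z"
        by (simp add: dist_norm norm_mult norm_power flip: right_diff_distrib)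
      then have "dist (f (?\<omega> ^ k * z')) (f (?\<omega> ^ k * z)) < 1/4"
        using that by (intro uc) (auto simp: norm_mult norm_power)
      then show "norm (f (?\<omega> ^ k * z') - f (?\<omega> ^ k * z)) \<le> 1/4"
        by (simp add: dist_norm)
    qed
    moreover have "F n z' - F n z = (1 / real n) *\<^sub>R (\<Sum>k<n. f (?\<omega> ^ k * z') - f (?\<omega> ^ k * z))"
      by (simp add: F_def sum_subtractf scaleR_diff_right)
    ultimately show ?thesis using that(1) by (simp add: field_simps)
  qed
  have pow: "norm (complex_of_real r ^ n *\<^sub>C s ^ n) = r ^ n * norm (s ^ n)" if "r \<ge> 0" for r n
    using that by (simp add: norm_scaleC norm_power)
  have one: "norm (1::'a) > 0" by simp
  have "\<forall>r. 0 \<le> r \<longrightarrow> r \<le> real m * (\<delta>/2) \<longrightarrow> r < R \<longrightarrow> (\<lambda>n. r ^ n * norm (s ^ n)) \<longlonglongrightarrow> 0" for m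
  proof (induction m)
    case 0
    \<comment> \<open>Only eventually zero: the term at \<open>n = 0\<close> is
      \<open>norm 1\<close>.\<close>
    have "(\<lambda>n. (0::real) ^ n * norm (s ^ n)) \<longlonglongrightarrow> 0"
      by (rule tendsto_eventually) (auto intro!: eventually_sequentiallyI[of 1])
    then show ?case by auto
  next
    case (Suc m)
    show ?case
    proof (intro allI impI)
      fix r assume r: "0 \<le> r" "r \<le> real (Suc m) * (\<delta>/2)" "r < R"
      define r0 where "r0 = max 0 (r - \<delta>/2)"
      have r0: "0 \<le> r0" "r0 \<le> real m * (\<delta>/2)" "r0 \<le> r" "r - r0 \<le> \<delta>/2"
        using r(1,2) \<delta> by (auto simp: r0_def max_def algebra_simps)
      have lim: "(\<lambda>n. r0 ^ n * norm (s ^ n)) \<longlonglongrightarrow> 0" using Suc r0 r by auto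
      \<comment> \<open>Boundedness is shown at \<open>r1\<close>, strictly beyond \<open>r\<close>,
        so that the ratio \<open>r / r1 < 1\<close> yields convergence at \<open>r\<close>. The
        distance from \<open>r0\<close> to \<open>r1\<close> stays below
        \<open>\<delta>\<close>.\<close>
      define r1 where "r1 = min R (r + \<delta>/4)"
      have r1: "r < r1" "r1 \<le> R" "r1 - r0 < \<delta>" using r r0 \<delta> by (auto simp: r1_def)
      \<comment> \<open>The first bound allows \<open>inverse_near_one\<close>; the second makes its
        estimate \<open>1/5 * 5/4 = 1/4\<close>. Adding the \<open>1/4\<close> from
        \<open>F_near\<close> gives the \<open>1/2\<close> required at \<open>r1\<close>.\<close>
      have "\<forall>\<^sub>F n in sequentially. r0 ^ n * norm (s ^ n) < min (1/5) (1 / (5 * norm (1::'a)))"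
        using one by (intro order_tendstoD[OF lim]) auto
      then have ev: "\<forall>\<^sub>F n in sequentially. r1 ^ n * norm (s ^ n) \<le> norm (1::'a)"
        using eventually_gt_at_top[of 0]
      proof eventually_elim
        case (elim n)
        have *: "r0 ^ n * norm (s ^ n) * norm (1::'a) \<le> 1/5"
          using elim(1) one by (simp add: field_simps)
        have "norm (F n r0 - 1) \<le> r0 ^ n * norm (s ^ n) * norm (1::'a) * (5/4)"
          using inverse_near_one[OF F_inv[OF elim(2)], of "complex_of_real r0"] elim(1)
          unfolding pow[OF r0(1)] by simp
        then have "norm (F n r0 - 1) \<le> 1/4" using * by linarith
        moreover have "norm (F n r1 - F n r0) \<le> 1/4"
          using r r0 r1 elim(2) by (intro F_near) (auto simp: dist_norm simp flip: of_real_diff)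
        moreover have "norm (F n r1 - 1) \<le> norm (F n r1 - F n r0) + norm (F n r0 - 1)"
          using norm_triangle_ineq[of "F n r1 - F n r0" "F n r0 - 1"] by simp
        ultimately have "norm (F n r1 - 1) \<le> 1/2" by linarith
        then have "norm (complex_of_real r1 ^ n *\<^sub>C s ^ n) \<le> norm (1::'a)"
          by (rule norm_le_of_inverse_near_one[OF F_inv[OF elim(2)]])
        then show ?case using r r1 pow[of r1 n] by simp
      qed
      have "\<forall>\<^sub>F n in sequentially. norm (r ^ n * norm (s ^ n)) \<le> (r / r1) ^ n * norm (1::'a)"
        using ev
      proof eventually_elim
        case (elim n)
        have "r ^ n * norm (s ^ n) = (r / r1) ^ n * (r1 ^ n * norm (s ^ n))"
          using r r1 by (simp add: power_divide)
        also have "\<dots> \<le> (r / r1) ^ n * norm (1::'a)"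
          using r r1 elim by (intro mult_left_mono) auto
        finally show ?case using r by simp
      qed
      moreover have "(\<lambda>n. (r / r1) ^ n * norm (1::'a)) \<longlonglongrightarrow> 0"
        using r r1 by (intro tendsto_mult_left_zero LIMSEQ_power_zero) auto
      ultimately show "(\<lambda>n. r ^ n * norm (s ^ n)) \<longlonglongrightarrow> 0"
        by (rule Lim_null_comparison)
    qed
  qed
  moreover obtain m where "t \<le> real m * (\<delta>/2)"
    using \<delta> ex_less_of_nat_mult[of "\<delta>/2" t] by (metis half_gt_zero less_imp_le)
  ultimately show ?thesis using assms(2) by (auto simp: R_def)
qed

lemma quasinilpotent_summable_powers:
  fixes s :: "'a::complex_banach_algebra"
  assumes "quasinilpotent s"
  shows "summable (\<lambda>n. s ^ n)"
proof -
  \<comment> \<open>Any radius above 1 would give a convergent geometric majorant; 2 gives ratio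
    \<open>1/2\<close>.\<close>
  have "\<forall>\<^sub>F n in sequentially. 2 ^ n * norm (s ^ n) < 1"
    using quasinilpotent_powers_tendsto_0[OF assms, of 2] by (auto intro: order_tendstoD)
  then have "\<forall>\<^sub>F n in sequentially. norm (s ^ n) \<le> (1/2) ^ n"
    by eventually_elim (simp add: field_simps)
  then show ?thesis
    by (rule summable_comparison_test_ev) (simp add: summable_geometric)
qed

text \<open>Iterating the equation puts \<open>s ^ n\<close> on one side and \<open>p ^ n\<close> on
  the other. The powers of \<open>s\<close> beat every geometric growth, so \<open>norm x\<close> is
  bounded by a null sequence. The two alternatives serve the two off-diagonal corners.\<close>

lemma sandwich_eq_0:
  fixes s x p :: "'a::complex_banach_algebra"
  assumes s: "quasinilpotent s" and x: "x = c *\<^sub>C (p * x * s) \<or> x = c *\<^sub>C (s * x * p)"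
  shows "x = 0"
proof -
  define t where "t = cmod c * norm p"
  have "\<exists>C. \<forall>n. norm x \<le> t ^ n * norm (s ^ n) * C"
    using x
  proof
    assume x: "x = c *\<^sub>C (p * x * s)"
    have p_left: "p ^ n * (p * y) = p * (p ^ n * y)" for n y
      by (metis mult.assoc power_commutes)
    have eq: "x = c ^ n *\<^sub>C (p ^ n * (x * s ^ n))" for n
    proof (induction n)
      case (Suc n)
      have "x = c ^ n *\<^sub>C (p ^ n * (c *\<^sub>C (p * x * s) * s ^ n))" using Suc x by simp
      then show ?case
        by (simp add: mult_scaleC_left mult_scaleC_right scaleC_scaleC mult.assoc
            power_commutes[of c] power_Suc2 p_left)
    qed (simp add: scaleC_one)
    have "norm x \<le> t ^ n * norm (s ^ n) * norm x" for n
    proof -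
      have "norm x = cmod c ^ n * norm (p ^ n * (x * s ^ n))"
        by (subst eq[of n]) (simp add: norm_scaleC norm_power)
      also have "\<dots> \<le> cmod c ^ n * (norm p ^ n * (norm x * norm (s ^ n)))"
        by (intro mult_left_mono order_trans[OF norm_power_mult_le] norm_mult_ineq) auto
      finally show ?thesis by (simp add: t_def power_mult_distrib mult_ac)
    qed
    then show ?thesis by blast
  next
    assume x: "x = c *\<^sub>C (s * x * p)"
    have s_left: "s ^ n * (s * y) = s * (s ^ n * y)" for n y
      by (metis mult.assoc power_commutes)
    have eq: "x = c ^ n *\<^sub>C (s ^ n * x * p ^ n)" for n
    proof (induction n)
      case (Suc n)
      have "x = c ^ n *\<^sub>C (s ^ n * (c *\<^sub>C (s * x * p)) * p ^ n)" using Suc x by simp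
      then show ?case
        by (simp add: mult_scaleC_left mult_scaleC_right scaleC_scaleC mult.assoc
            power_commutes[of c] power_Suc2 s_left)
    qed (simp add: scaleC_one)
    have "norm x \<le> t ^ n * norm (s ^ n) * (norm x * norm (1::'a))" for n
    proof -
      have "norm x = cmod c ^ n * norm (s ^ n * x * p ^ n)"
        by (subst eq[of n]) (simp add: norm_scaleC norm_power)
      \<comment> \<open>Here \<open>p ^ n\<close> stands alone; writing it as
        \<open>p ^ n * 1\<close> admits \<open>norm_power_mult_le\<close> at the price of a constant
        \<open>norm 1\<close>.\<close>
      also have "\<dots> \<le> cmod c ^ n * (norm (s ^ n) * norm x * norm (p ^ n * 1))"
        by (intro mult_left_mono order_trans[OF norm_mult_ineq] mult_mono norm_mult_ineq) auto
      also have "\<dots> \<le> cmod c ^ n * (norm (s ^ n) * norm x * (norm p ^ n * norm (1::'a)))"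
        by (intro mult_left_mono norm_power_mult_le) auto
      finally show ?thesis by (simp add: t_def power_mult_distrib mult_ac)
    qed
    then show ?thesis by blast
  qed
  then obtain C where C: "\<And>n. norm x \<le> t ^ n * norm (s ^ n) * C" by blast
  have "(\<lambda>n. t ^ n * norm (s ^ n) * C) \<longlonglongrightarrow> 0"
    by (intro tendsto_mult_left_zero quasinilpotent_powers_tendsto_0 s) (simp add: t_def)
  then have "norm x \<le> 0" using C by (intro LIMSEQ_le_const) auto
  then show ?thesis by simp
qed

section \<open>Pseudo Drazin inverses\<close>

text \<open>The trailing \<open>e\<close> on the left makes the identity hold at
  \<open>n = 0\<close> too.\<close>

lemma power_mult_idempotent:
  fixes a e :: "'a::monoid_mult"
  assumes "e * e = e" "e * a = a * e"
  shows "(a * e) ^ n * e = a ^ n * e"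
proof (induction n)
  case (Suc n)
  have "(a * e) ^ Suc n * e = a * (e * (a ^ n * e))" using Suc by (simp add: mult.assoc)
  also have "e * (a ^ n * e) = a ^ n * e"
    using power_commuting_commutes[of a e n] assms by (metis mult.assoc)
  finally show ?case by (simp add: mult.assoc)
qed simp

lemma power_mult_idempotent':
  fixes a e :: "'a::monoid_mult"
  assumes "e * e = e" "e * a = a * e" "n \<ge> 1"
  shows "(a * e) ^ n = a ^ n * e"
proof -
  obtain m where n: "n = Suc m" using assms(3) by (cases n) auto
  have "(a * e) ^ n = (a * e) ^ m * a * e" by (simp add: n power_commutes mult.assoc)
  also have "\<dots> = (a * e) ^ m * e * a * e" using assms by (metis mult.assoc)
  also have "\<dots> = a ^ m * (e * a * e)" 
    by (simp add: power_mult_idempotent[OF assms(1,2)] mult.assoc)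
  also have "\<dots> = a ^ n * e" using assms by (simp add: n power_Suc2 mult.assoc del: power_Suc)
  finally show ?thesis .
qed

lemma is_pDrazin_inverse_iff:
  "is_pDrazin_inverse a x \<longleftrightarrow> a * x = x * a \<and> x * a * x = x \<and>
     (\<exists>k\<ge>1. a ^ k * (1 - a * x) \<in> jacobson_radical)"
  by (simp add: is_pDrazin_inverse_def right_diff_distrib power_Suc2 mult.assoc del: power_Suc)

lemma jacobson_radical_power_ge:
  assumes "a ^ k * r \<in> jacobson_radical" "k \<le> n"
  shows "a ^ n * r \<in> jacobson_radical"
  using jacobson_radical_mult_left[OF assms(1), of "a ^ (n - k)"] assms(2)
  by (simp add: mult.assoc[symmetric] power_add[symmetric])

lemma pDrazin_idempotent_idem:
  assumes "is_pDrazin_inverse a p"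
  shows "(a * p) * (a * p) = a * p"
  using assms by (metis is_pDrazin_inverse_def mult.assoc)

text \<open>With \<open>R = 1 - P\<close>, the element \<open>a * R\<close> is quasinilpotent, and
  both off-diagonal corners of \<open>b\<close> satisfy sandwich equations, so they vanish and
  \<open>b\<close> commutes with \<open>P\<close>. Multiplying
  \<open>a * b = c *\<^sub>C (b * a)\<close> by \<open>p\<close> on both sides then gives the second
  relation.\<close>

lemma pDrazin_commute:
  fixes a b p :: "'a::complex_banach_algebra"
  assumes p: "is_pDrazin_inverse a p" and ab: "a * b = c *\<^sub>C (b * a)" and c: "c \<noteq> 0"
  shows "a * p * b = b * (a * p)" "b * p = c *\<^sub>C (p * b)"
proof -
  define P R where "P = a * p" and "R = 1 - P"
  have pa: "p * a = P" and pap: "p * a * p = p"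
    using p by (auto simp: is_pDrazin_inverse_def P_def)
  have PP: "P * P = P" using pDrazin_idempotent_idem[OF p] by (simp add: P_def)
  have pP: "p * P = p" "P * p = p" using pap by (metis P_def mult.assoc) (metis pa pap)
  have aP: "a * P = P * a" by (simp add: P_def mult.assoc pa)
  have RR: "R * R = R" and Ra: "R * a = a * R"
    by (simp_all add: R_def algebra_simps PP aP)
  obtain k where k: "k \<ge> 1" "a ^ k * R \<in> jacobson_radical"
    using p by (auto simp: is_pDrazin_inverse_iff P_def R_def)
  have "(a * R) ^ k = a ^ k * R" by (rule power_mult_idempotent'[OF RR Ra k(1)])
  with k(2) have qn: "quasinilpotent (a * R)"
    by (intro quasinilpotent_of_power_in_jacobson_radical[of _ k]) simp
  have ba: "b * a = inverse c *\<^sub>C (a * b)"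
    using c by (simp add: ab scaleC_scaleC scaleC_one)
  have RaR: "R * (a * R) = a * R" by (simp add: mult.assoc[symmetric] Ra) (simp add: mult.assoc RR)
  \<comment> \<open>Write \<open>P = p * a\<close> and move \<open>a\<close> past \<open>b\<close>;
    reinserting \<open>P\<close> and \<open>R\<close> around \<open>b\<close> reproduces the
    corner.\<close>
  have "P * b * R = c *\<^sub>C (p * (P * b * R) * (a * R))"
  proof -
    have "p * (P * b * R) * (a * R) = (p * P) * b * (R * (a * R))" by (simp only: mult.assoc)
    also have "\<dots> = p * (b * a) * R" by (simp add: pP RaR mult.assoc)
    finally have "c *\<^sub>C (p * (P * b * R) * (a * R)) = p * (a * b) * R"
      by (simp add: ab mult_scaleC_left mult_scaleC_right)
    then show ?thesis by (simp add: pa[symmetric] mult.assoc)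
  qed
  then have PbR: "P * b * R = 0" using sandwich_eq_0[OF qn] by blast
  have "R * b * P = inverse c *\<^sub>C ((a * R) * (R * b * P) * p)"
  proof -
    have "(a * R) * (R * b * P) * p = a * (R * R) * b * (P * p)" by (simp only: mult.assoc)
    also have "\<dots> = R * (a * b) * p" by (simp add: pP RR Ra mult.assoc[symmetric])
    finally have "inverse c *\<^sub>C ((a * R) * (R * b * P) * p) = R * (b * a) * p"
      by (simp add: ba mult_scaleC_left mult_scaleC_right)
    then show ?thesis by (simp add: P_def mult.assoc)
  qed
  then have RbP: "R * b * P = 0" using sandwich_eq_0[OF qn] by blast
  have "P * b = P * b * P" using PbR by (simp add: R_def right_diff_distrib)
  moreover have "b * P = P * b * P" using RbP by (simp add: R_def left_diff_distrib)
  ultimately have Pb: "P * b = b * P" by simp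
  then show "a * p * b = b * (a * p)" by (simp add: P_def)
  have "c *\<^sub>C (p * b) = c *\<^sub>C (p * (P * b))"
    by (simp add: mult.assoc[symmetric] pP)
  also have "\<dots> = p * (c *\<^sub>C (b * a)) * p"
    unfolding Pb by (simp add: P_def mult.assoc mult_scaleC_left mult_scaleC_right)
  also have "\<dots> = P * b * p" by (simp add: ab[symmetric] pa[symmetric] mult.assoc)
  also have "\<dots> = b * p" by (simp add: Pb pP mult.assoc)
  finally show "b * p = c *\<^sub>C (p * b)" by simp
qed

lemma pDrazin_double_commute:
  fixes a b p :: "'a::complex_banach_algebra"
  assumes "is_pDrazin_inverse a p" "a * b = b * a"
  shows "p * b = b * p"
  using pDrazin_commute(2)[of a p b 1] assms by (simp add: scaleC_one)

text \<open>For the commuting idempotents \<open>e = a * x\<close> and \<open>f = a * y\<close>, the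
  idempotent \<open>e * (1 - f) = x ^ k * (a ^ k * (1 - f))\<close> lies in the radical and so is 0.
  Thus \<open>x = x * e = x * e * f = x * f\<close>.\<close>

lemma pDrazin_inverse_absorb:
  fixes a x y :: "'a::complex_banach_algebra"
  assumes x: "is_pDrazin_inverse a x" and y: "is_pDrazin_inverse a y"
  shows "x * (a * y) = x"
proof -
  define e f where "e = a * x" and "f = a * y"
  have ax: "a * x = x * a" and xax: "x * a * x = x" and ay: "a * y = y * a"
    using x y by (auto simp: is_pDrazin_inverse_def)
  have ee: "e * e = e" "f * f = f"
    using pDrazin_idempotent_idem[OF x] pDrazin_idempotent_idem[OF y] by (auto simp: e_def f_def)
  have xy: "x * y = y * x" using pDrazin_double_commute[OF x ay] .
  have ef: "e * f = f * e"
    unfolding e_def f_def using ax ay xy by (metis mult.assoc)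
  obtain k where k: "k \<ge> 1" "a ^ k * (1 - f) \<in> jacobson_radical"
    using y by (auto simp: is_pDrazin_inverse_iff f_def)
  have "e ^ k = x ^ k * a ^ k"
    unfolding e_def ax
  proof (induction k)
    case (Suc n)
    then show ?case
      using power_commuting_commutes[of x a n] ax
      by (simp add: mult.assoc) (metis mult.assoc power_commutes)
  qed simp
  moreover have "e ^ k = e" using k(1) ee(1) by (induction k rule: nat_induct_at_least) simp_all
  ultimately have "e * (1 - f) = x ^ k * (a ^ k * (1 - f))" by (metis mult.assoc)
  then have "e * (1 - f) \<in> jacobson_radical" using jacobson_radical_mult_left[OF k(2)] by simp
  moreover have "(e * (1 - f)) * (e * (1 - f)) = e * (1 - f)"
  proof -
    have "(1 - f) * e = e * (1 - f)" "(1 - f) * (1 - f) = 1 - f"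
      by (simp_all add: algebra_simps ef ee)
    then show ?thesis by (metis ee(1) mult.assoc)
  qed
  ultimately have "e * (1 - f) = 0" by (rule idempotent_in_jacobson_radical[rotated])
  then have "x * e * f = x * e" by (simp add: algebra_simps)
  moreover have "x * e = x" using xax by (simp add: e_def mult.assoc)
  ultimately show ?thesis by (simp add: f_def)
qed

text \<open>Absorption in both directions, with \<open>x\<close> and \<open>y\<close> commuting by
  double commutation.\<close>

lemma is_pDrazin_inverse_unique:
  fixes a x y :: "'a::complex_banach_algebra"
  assumes x: "is_pDrazin_inverse a x" and y: "is_pDrazin_inverse a y"
  shows "x = y"
proof -
  have "x = x * (a * y)" using pDrazin_inverse_absorb[OF x y] by simp
  also have "\<dots> = y * (a * x)"
    using x y pDrazin_double_commute[OF x, of y]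
    by (simp add: is_pDrazin_inverse_def) (metis mult.assoc)
  also have "\<dots> = y" by (rule pDrazin_inverse_absorb[OF y x])
  finally show ?thesis .
qed

lemma pDrazin_inverse_eqI:
  fixes a x :: "'a::complex_banach_algebra"
  assumes "is_pDrazin_inverse a x"
  shows "a\<^sup>\<ddagger> = x"
  unfolding pDrazin_inverse_def using assms is_pDrazin_inverse_unique by blast

lemma is_pDrazin_inverse_pDrazin_inverse:
  fixes a :: "'a::complex_banach_algebra"
  assumes "pDrazin_invertible a"
  shows "is_pDrazin_inverse a (a\<^sup>\<ddagger>)"
  using assms pDrazin_inverse_eqI by (auto simp: pDrazin_invertible_def)

section \<open>Peirce corners\<close>

text \<open>By double commutation \<open>z\<close> commutes with \<open>E\<close>, so the defining
  identities may be multiplied by \<open>E\<close>. This passes from \<open>a - b\<close> to its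
  block \<open>w\<close>.\<close>

lemma pDrazin_corner:
  fixes d z E :: "'a::complex_banach_algebra"
  assumes z: "is_pDrazin_inverse d z" and E: "E * E = E" "E * d = d * E"
  shows "is_pDrazin_inverse (d * E) (z * E)"
proof -
  have dz: "d * z = z * d" and zdz: "z * d * z = z" using z by (auto simp: is_pDrazin_inverse_def)
  have zE: "z * E = E * z" using pDrazin_double_commute[OF z] E(2) by simp
  have prod: "d * E * (z * E) = d * z * E" "z * E * (d * E) = z * d * E"
    by (metis E mult.assoc zE) (metis E mult.assoc)
  obtain k where k: "k \<ge> 1" "d ^ k * (1 - d * z) \<in> jacobson_radical"
    using z by (auto simp: is_pDrazin_inverse_iff)
  have "(d * E) ^ k * (1 - d * E * (z * E)) = d ^ k * E * (1 - d * z * E)"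
    by (simp only: power_mult_idempotent'[OF E k(1)] prod)
  also have "\<dots> = d ^ k * (E * (1 - d * z * E))" by (rule mult.assoc)
  also have "E * (1 - d * z * E) = (1 - d * z) * E"
  proof -
    have "E * (d * z * E) = d * z * E" by (metis E mult.assoc zE)
    then show ?thesis by (simp add: algebra_simps)
  qed
  finally have "(d * E) ^ k * (1 - d * E * (z * E)) = (d ^ k * (1 - d * z)) * E"
    by (simp add: mult.assoc)
  then have "(d * E) ^ k * (1 - d * E * (z * E)) \<in> jacobson_radical"
    using jacobson_radical_mult_right[OF k(2)] by simp
  moreover have "z * E * (d * E) * (z * E) = z * E"
    using prod(2) zdz by (metis E mult.assoc zE)
  ultimately show ?thesis using k(1) dz prod by (auto simp: is_pDrazin_inverse_iff)
qed

text \<open>Here \<open>U\<close> inverts \<open>d\<close> in the corner of \<open>H\<close>, and \<open>d\<close> is radical-nilpotent in the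
  corner of \<open>1 - E - H\<close>.\<close>

lemma pDrazin_glue:
  fixes d v U E H :: "'a::ring_1"
  assumes v: "is_pDrazin_inverse (d * E) v"
    and E: "E * E = E" "E * d = d * E"
    and H: "E * H = 0" "H * E = 0" "d * U = H" "U * d = H" "U * H = U"
    and n: "d ^ n * (1 - E - H) \<in> jacobson_radical"
  shows "is_pDrazin_inverse d (v + U)"
proof -
  define w where "w = d * E"
  have wv: "w * v = v * w" and vwv: "v * w * v = v"
    using v by (auto simp: is_pDrazin_inverse_def w_def)
  have wE: "w * E = w" "E * w = w" 
    using E by (metis w_def mult.assoc)+
  \<comment> \<open>Since \<open>w\<close> absorbs \<open>E\<close> on both sides, these identities
    place \<open>v\<close> in the corner of \<open>E\<close>; hence
    \<open>v * H = 0\<close>.\<close>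
  have "v * v * w = v" "w * v * v = v" using wv vwv by (simp_all add: mult.assoc)
  then have vE: "v * E = v" "E * v = v" using wE by (metis mult.assoc)+
  have dv: "d * v = w * v" using vE by (metis w_def mult.assoc)
  have vd: "v * d = v * w" using vE E by (metis w_def mult.assoc)
  have vH: "v * H = 0" using vE H by (metis mult.assoc mult_zero_right)
  have Uw: "U * w = 0" using H E by (metis w_def mult.assoc mult_zero_right)
  obtain k where k: "k \<ge> 1" "w ^ k * (1 - w * v) \<in> jacobson_radical"
    using v by (auto simp: is_pDrazin_inverse_iff w_def)
  define m where "m = max k n"
  have m: "m \<ge> 1" "k \<le> m" "n \<le> m" using k(1) by (auto simp: m_def)
  have prod: "d * (v + U) = w * v + H" by (simp add: distrib_left dv H)
  have prod': "(v + U) * d = v * w + H" by (simp add: distrib_right vd H)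
  have "w ^ m * (1 - w * v) = d ^ m * (E * (1 - w * v))"
    by (simp add: w_def power_mult_idempotent'[OF E m(1)] mult.assoc)
  also have "E * (1 - w * v) = E - w * v"
    using wE by (simp add: right_diff_distrib mult.assoc[symmetric])
  finally have wm: "w ^ m * (1 - w * v) = d ^ m * (E - w * v)" .
  \<comment> \<open>The complement \<open>1 - d * (v + U)\<close> splits as
    \<open>(E - w * v) + (1 - E - H)\<close>; the exponent \<open>m\<close> is large enough for both
    parts.\<close>
  have "d ^ m * (1 - d * (v + U)) = w ^ m * (1 - w * v) + d ^ m * (1 - E - H)"
    by (simp only: prod wm distrib_left[symmetric]) (simp add: algebra_simps)
  then have "d ^ m * (1 - d * (v + U)) \<in> jacobson_radical"
    using jacobson_radical_add jacobson_radical_power_ge[OF k(2) m(2)]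
      jacobson_radical_power_ge[OF n m(3)] by simp
  moreover have "(v + U) * d * (v + U) = v + U"
  proof -
    have "(v + U) * d * (v + U) = (v + U) * (w * v + H)" by (simp only: mult.assoc prod)
    also have "\<dots> = v * (w * v) + v * H + (U * w * v + U * H)"
      by (simp add: distrib_left distrib_right mult.assoc add_ac)
    also have "\<dots> = v + U" using vwv vH Uw H by (simp add: mult.assoc)
    finally show ?thesis .
  qed
  moreover have "d * (v + U) = (v + U) * d" by (simp add: prod prod' wv)
  ultimately show ?thesis using m(1) by (auto simp: is_pDrazin_inverse_iff)
qed

section \<open>Neumann series in the mixed corners and the radical-nilpotent corner\<close>

lemma power_mult_shift: "(x * y) ^ n * x = x * (y * x) ^ n" for x :: "'a::monoid_mult"
  by (induction n) (simp_all add: mult.assoc)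

text \<open>In the corner of \<open>a * p * R\<close> the inverse of \<open>a\<close> is
  \<open>p\<close>, so \<open>a - b = (1 - b * p) * a\<close> there and \<open>X\<close> is the
  Neumann series of its inverse. The verification telescopes.\<close>

lemma corner_series_inverse:
  fixes a b p R :: "'a::complex_banach_algebra"
  assumes p: "a * p = p * a" "p * a * p = p" and b: "a * p * b = b * (a * p)"
    and R: "R * R = R" "R * a = a * R" "R * b = b * R" "R * p = p * R"
    and sum: "summable (\<lambda>i. (b * p) ^ i * R)"
  defines "X \<equiv> (\<Sum>i. p * (b * p) ^ i * R)"
  shows "summable (\<lambda>i. p * (b * p) ^ i * R)" "(a - b) * X = a * p * R" "X * (a - b) = a * p * R"
    "X * (a * p * R) = X"
proof -
  define P where "P = a * p"
  have pP: "p * P = p" "P * p = p" and Pb: "P * b = b * P" and ap: "a * p = P" and pa: "p * a = P"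
    and RP: "R * P = P * R"
    using p b R by (simp_all add: P_def mult.assoc) (metis mult.assoc)+
  have PP: "P * P = P" using pP(1) by (metis P_def mult.assoc)
  define g where "g i = p * (b * p) ^ i * R" for i
  show s: "summable (\<lambda>i. p * (b * p) ^ i * R)"
    using summable_mult[OF sum, of p] by (simp add: mult.assoc)
  then have sg: "g sums X" unfolding g_def X_def by (rule summable_sums)
  have gR: "g i * R = g i" and gP: "g i * P = g i" for i
  proof -
    show "g i * R = g i" by (simp add: g_def mult.assoc R)
    have "g i * P = p * (b * p) ^ i * P * R" by (simp add: g_def mult.assoc RP)
    also have "p * (b * p) ^ i * P = p * (b * p) ^ i"
      using power_mult_shift[of p b i] pP(1) by (metis mult.assoc)
    finally show "g i * P = g i" by (simp add: g_def)
  qed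
  \<comment> \<open>Left multiplication by \<open>a\<close> shifts the series: apart from its first
    term \<open>P * R\<close>, it becomes the series multiplied by \<open>b\<close>. The same holds
    on the right in \<open>ga\<close>.\<close>
  have ag: "a * g 0 = P * R" "a * g (Suc i) = b * g i" for i
  proof -
    show "a * g 0 = P * R" by (simp add: g_def ap mult.assoc[symmetric])
    have "a * g (Suc i) = P * b * p * (b * p) ^ i * R" by (simp add: g_def ap mult.assoc[symmetric])
    also have "P * b * p = b * p" by (simp add: Pb mult.assoc pP)
    finally show "a * g (Suc i) = b * g i" by (simp add: g_def mult.assoc)
  qed
  have ga: "g 0 * a = P * R" "g (Suc i) * a = g i * b" for i
  proof -
    have Ra: "g i * a = p * (b * p) ^ i * a * R" for i by (simp add: g_def mult.assoc R)
    show "g 0 * a = P * R" using Ra[of 0] by (simp add: pa)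
    have "g (Suc i) * a = p * ((b * p) ^ i * b) * (p * a) * R"
      by (simp add: Ra power_Suc2 mult.assoc del: power_Suc)
    also have "\<dots> = p * (b * p) ^ i * P * b * R"
      by (simp add: pa mult.assoc Pb[symmetric])
    also have "p * (b * p) ^ i * P = p * (b * p) ^ i"
      using power_mult_shift[of p b i] pP(1) by (metis mult.assoc)
    finally show "g (Suc i) * a = g i * b" by (simp add: g_def mult.assoc R)
  qed
  have "(\<lambda>i. a * g i) sums (b * X + P * R)"
    using sums_Suc[of "\<lambda>i. a * g i" "b * X"] sums_mult[OF sg, of b] by (simp add: ag)
  then have "a * X = b * X + P * R" using sums_mult[OF sg, of a] sums_unique2 by blast
  then show "(a - b) * X = a * p * R" by (simp add: left_diff_distrib P_def)
  have "(\<lambda>i. g i * a) sums (X * b + P * R)"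
    using sums_Suc[of "\<lambda>i. g i * a" "X * b"] sums_mult2[OF sg, of b] by (simp add: ga)
  then have "X * a = X * b + P * R" using sums_mult2[OF sg, of a] sums_unique2 by blast
  then show "X * (a - b) = a * p * R" by (simp add: right_diff_distrib P_def)
  have "g i * (P * R) = g i" for i using gR gP by (metis mult.assoc)
  then have "X * (P * R) = X" using sums_mult2[OF sg, of "P * R"] sg sums_unique2 by auto
  then show "X * (a * p * R) = X" by (simp add: P_def)
qed

text \<open>Termwise estimates via \<open>p\<^sup>i b\<^sup>i\<close> would fail, as the commutation factor is \<open>c\<close> to an exponent
  quadratic in \<open>i\<close>. Instead, \<open>b p R\<close> itself is quasinilpotent, because one of its powers is
  in the radical.\<close>

lemma corner_series_summable:
  fixes b p R :: "'a::complex_banach_algebra"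
  assumes bp: "b * p = c *\<^sub>C (p * b)"
    and R: "R * R = R" "R * b = b * R" "R * p = p * R"
    and k: "k \<ge> 1" "b ^ k * R \<in> jacobson_radical"
  shows "summable (\<lambda>i. (b * p) ^ i * R)"
proof -
  have b_p: "b * p ^ n = c ^ n *\<^sub>C (p ^ n * b)" for n
  proof (induction n)
    case (Suc n)
    have "b * p ^ Suc n = c *\<^sub>C (p * (b * p ^ n))"
      by (simp add: bp mult.assoc[symmetric] mult_scaleC_left)
    then show ?case by (simp add: Suc mult_scaleC_right scaleC_scaleC mult.assoc)
  qed (simp add: scaleC_one)
  \<comment> \<open>The scalar stays existential, because radical membership is insensitive to
    it.\<close>
  have "\<exists>e. (b * p) ^ n = e *\<^sub>C (p ^ n * b ^ n)" for n
  proof (induction n)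
    case 0
    show ?case by (rule exI[of _ 1]) (simp add: scaleC_one)
  next
    case (Suc n)
    then obtain e where "(b * p) ^ n = e *\<^sub>C (p ^ n * b ^ n)" by auto
    then have "(b * p) ^ Suc n = e *\<^sub>C ((b * p ^ Suc n) * b ^ n)"
      by (simp add: mult_scaleC_right mult.assoc)
    also have "\<dots> = (e * c ^ Suc n) *\<^sub>C (p ^ Suc n * b ^ Suc n)"
      by (simp only: b_p mult_scaleC_left scaleC_scaleC) (simp add: mult.assoc)
    finally show ?case by blast
  qed
  then obtain e where "(b * p) ^ k = e *\<^sub>C (p ^ k * b ^ k)" by blast
  then have "(b * p) ^ k * R = e *\<^sub>C (p ^ k * (b ^ k * R))"
    by (simp add: mult_scaleC_left mult.assoc)
  then have J: "(b * p) ^ k * R \<in> jacobson_radical"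
    by (simp add: jacobson_radical_scaleC jacobson_radical_mult_left k(2))
  have Rbp: "R * (b * p) = b * p * R" by (metis R(2,3) mult.assoc)
  have "quasinilpotent (b * p * R)"
    using J power_mult_idempotent'[OF R(1) Rbp k(1)]
    by (intro quasinilpotent_of_power_in_jacobson_radical[of _ k]) simp
  \<comment> \<open>The extra \<open>R\<close> matches the summands with
    \<open>(b * p) ^ i * R\<close> at \<open>i = 0\<close> as well.\<close>
  then have "summable (\<lambda>i. (b * p * R) ^ i * R)"
    by (intro summable_mult2 quasinilpotent_summable_powers)
  then show ?thesis by (simp add: power_mult_idempotent[OF R(1) Rbp])
qed

text \<open>Each step moves one factor of \<open>a - b\<close> into \<open>a ^ i\<close> or
  \<open>b ^ j\<close>, up to a scalar, keeping \<open>n + i + j\<close> fixed. At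
  \<open>n = 0\<close> this degree forces \<open>i\<close> or \<open>j\<close> to be at least
  \<open>k\<close>. The exponents \<open>i\<close>, \<open>j\<close> generalize the induction and
  avoid noncommutative binomial coefficients.\<close>

lemma diff_power_in_jacobson_radical:
  fixes a b e :: "'a::complex_banach_algebra"
  assumes ba: "b * a = c *\<^sub>C (a * b)" and e: "e * b = b * e"
    and a: "a ^ k * e \<in> jacobson_radical" and b: "b ^ k * e \<in> jacobson_radical"
    and n: "n + i + j \<ge> 2 * k"
  shows "(a - b) ^ n * a ^ i * b ^ j * e \<in> jacobson_radical"
  using n
proof (induction n arbitrary: i j)
  case 0
  then consider "k \<le> i" | "k \<le> j" by linarith
  then show ?case
  proof cases
    case 1
    have "b ^ j * e = e * b ^ j" using power_commuting_commutes[of b e j] e by simp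
    then have "a ^ i * b ^ j * e = a ^ i * e * b ^ j" by (simp add: mult.assoc)
    then show ?thesis
      using jacobson_radical_mult_right[OF jacobson_radical_power_ge[OF a 1]] by simp
  next
    case 2
    then show ?thesis
      using jacobson_radical_mult_left[OF jacobson_radical_power_ge[OF b 2], of "a ^ i"]
      by (simp add: mult.assoc)
  qed
next
  case (Suc n)
  have b_a: "b * a ^ i = c ^ i *\<^sub>C (a ^ i * b)" for i
  proof (induction i)
    case (Suc i)
    have "b * a ^ Suc i = c *\<^sub>C (a * (b * a ^ i))"
      by (simp add: ba mult.assoc[symmetric] mult_scaleC_left)
    then show ?case by (simp add: Suc mult_scaleC_right scaleC_scaleC mult.assoc)
  qed (simp add: scaleC_one)
  have "(a - b) ^ Suc n * a ^ i * b ^ j * e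
    = (a - b) ^ n * (a * a ^ i) * b ^ j * e - (a - b) ^ n * (b * a ^ i) * b ^ j * e"
    by (simp add: power_Suc2 mult.assoc left_diff_distrib right_diff_distrib del: power_Suc)
  also have "\<dots> = (a - b) ^ n * a ^ Suc i * b ^ j * e
      - c ^ i *\<^sub>C ((a - b) ^ n * a ^ i * b ^ Suc j * e)"
    by (simp add: b_a mult_scaleC_left mult_scaleC_right mult.assoc)
  also have "\<dots> \<in> jacobson_radical"
    using Suc.prems by (intro jacobson_radical_diff jacobson_radical_scaleC Suc.IH) auto
  finally show ?case .
qed

text \<open>With \<open>p\<close>, \<open>q\<close>, \<open>v\<close> as explicit inverses, the last
  claim yields existence and formula at once. The second series is the first with \<open>a\<close>
  and \<open>b\<close> exchanged, so its scalar is \<open>inverse c\<close>.\<close>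

lemma diff_pDrazin_inverse:
  fixes a b p q :: "'a::complex_banach_algebra"
  assumes p: "is_pDrazin_inverse a p" and q: "is_pDrazin_inverse b q"
    and ab: "a * b = c *\<^sub>C (b * a)" and c: "c \<noteq> 0"
  defines "P \<equiv> a * p" and "Q \<equiv> b * q"
  shows "P * Q = Q * P" "P * (a - b) = (a - b) * P" "Q * (a - b) = (a - b) * Q"
    and "summable (\<lambda>i. p * (b * p) ^ i * (1 - Q))"
    and "summable (\<lambda>i. (1 - P) * (q * a) ^ i * q)"
    and "is_pDrazin_inverse ((a - b) * (P * Q)) v \<Longrightarrow> is_pDrazin_inverse (a - b)
      (v + (\<Sum>i. p * (b * p) ^ i * (1 - Q)) - (\<Sum>i. (1 - P) * (q * a) ^ i * q))"
proof -
  have ba: "b * a = inverse c *\<^sub>C (a * b)" and ic: "inverse c \<noteq> 0"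
    using c by (simp_all add: ab scaleC_scaleC scaleC_one)
  have ap: "a * p = p * a" "p * a * p = p" and bq: "b * q = q * b" "q * b * q = q"
    using p q by (auto simp: is_pDrazin_inverse_def)
  have PP: "P * P = P" and QQ: "Q * Q = Q"
    using pDrazin_idempotent_idem p q by (auto simp: P_def Q_def)
  have Pa: "P * a = a * P" and Qb: "Q * b = b * Q"
    using ap(1) bq(1) by (metis P_def mult.assoc, metis Q_def mult.assoc)
  have Pb: "P * b = b * P" and bp: "b * p = c *\<^sub>C (p * b)"
    using pDrazin_commute[OF p ab c] by (auto simp: P_def)
  have Qa: "Q * a = a * Q" and aq: "a * q = inverse c *\<^sub>C (q * a)"
    using pDrazin_commute[OF q ba ic] by (auto simp: Q_def)
  have Qp: "Q * p = p * Q" and Pp: "P * p = p * P"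
    using pDrazin_double_commute[OF p, of Q] pDrazin_double_commute[OF p, of P] Qa Pa by simp_all
  have Pq: "P * q = q * P"
    using pDrazin_double_commute[OF q, of P] Pb by simp
  show PQ: "P * Q = Q * P" using Pb Pq by (metis Q_def mult.assoc)
  show Pd: "P * (a - b) = (a - b) * P" and Qd: "Q * (a - b) = (a - b) * Q"
    by (simp_all add: algebra_simps Pa Pb Qa Qb)
  obtain k1 where k1: "k1 \<ge> 1" "a ^ k1 * (1 - P) \<in> jacobson_radical"
    using p by (auto simp: is_pDrazin_inverse_iff P_def)
  obtain k2 where k2: "k2 \<ge> 1" "b ^ k2 * (1 - Q) \<in> jacobson_radical"
    using q by (auto simp: is_pDrazin_inverse_iff Q_def)
  have R: "(1 - Q) * (1 - Q) = 1 - Q" "(1 - Q) * a = a * (1 - Q)" "(1 - Q) * b = b * (1 - Q)"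
    "(1 - Q) * p = p * (1 - Q)"
    by (simp_all add: algebra_simps QQ Qa Qb Qp)
  have S: "(1 - P) * (1 - P) = 1 - P" "(1 - P) * b = b * (1 - P)" "(1 - P) * a = a * (1 - P)"
    "(1 - P) * q = q * (1 - P)"
    by (simp_all add: algebra_simps PP Pa Pb Pq)
  define X Y where "X = (\<Sum>i. p * (b * p) ^ i * (1 - Q))" and "Y = (\<Sum>i. q * (a * q) ^ i * (1 - P))"
  note X = corner_series_inverse[OF ap Pb[unfolded P_def] R corner_series_summable[OF bp R(1,3,4) k2],
      folded X_def P_def]
  note Y = corner_series_inverse[OF bq Qa[unfolded Q_def] S corner_series_summable[OF aq S(1,3,4) k1],
      folded Y_def Q_def]
  \<comment> \<open>The exchange produces \<open>q * (a * q) ^ i * (1 - P)\<close>; push-through and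
    commutation with \<open>1 - P\<close> give the order used in the claim.\<close>
  have Y_eq: "(\<lambda>i. q * (a * q) ^ i * (1 - P)) = (\<lambda>i. (1 - P) * (q * a) ^ i * q)"
  proof
    fix i
    have "(1 - P) * (q * a) = q * a * (1 - P)" using S(3,4) by (metis mult.assoc)
    then have "(1 - P) * (q * a) ^ i = (q * a) ^ i * (1 - P)"
      using power_commuting_commutes[of "q * a" "1 - P" i] by simp
    then have "(1 - P) * (q * a) ^ i * q = (q * a) ^ i * q * (1 - P)"
      by (simp add: mult.assoc S(4))
    then show "q * (a * q) ^ i * (1 - P) = (1 - P) * (q * a) ^ i * q"
      by (simp only: power_mult_shift)
  qed
  show "summable (\<lambda>i. p * (b * p) ^ i * (1 - Q))" by (rule X(1))
  show "summable (\<lambda>i. (1 - P) * (q * a) ^ i * q)" using Y(1) by (simp only: Y_eq)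
  assume v: "is_pDrazin_inverse ((a - b) * (P * Q)) v"
  \<comment> \<open>\<open>H\<close> is the idempotent of the two mixed corners together, so
    \<open>1 - P * Q - H = (1 - P) * (1 - Q)\<close>.\<close>
  define H where "H = P * (1 - Q) + Q * (1 - P)"
  have QP': "Q * (P * z) = P * (Q * z)" and PP': "P * (P * z) = P * z" and QQ': "Q * (Q * z) = Q * z"
    for z using PQ PP QQ by (metis mult.assoc)+
  note idem = PQ[symmetric] QP' PP QQ PP' QQ'
  have "is_pDrazin_inverse (a - b) (v + (X - Y))"
  proof (rule pDrazin_glue[OF v])
    show "P * Q * (P * Q) = P * Q" "P * Q * H = 0" "H * (P * Q) = 0"
      by (simp_all add: H_def algebra_simps idem)
    show "P * Q * (a - b) = (a - b) * (P * Q)" using Pd Qd by (metis mult.assoc)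
    \<comment> \<open>\<open>Y\<close> inverts \<open>b - a\<close> in its corner, whence the minus
      sign before the second series.\<close>
    have "(a - b) * (X - Y) = (a - b) * X + (b - a) * Y" by (simp add: algebra_simps)
    then show "(a - b) * (X - Y) = H" by (simp add: X Y H_def)
    have "(X - Y) * (a - b) = X * (a - b) + Y * (b - a)" by (simp add: algebra_simps)
    then show "(X - Y) * (a - b) = H" by (simp add: X Y H_def)
    have "P * (1 - Q) * H = P * (1 - Q)" "Q * (1 - P) * H = Q * (1 - P)"
      by (simp_all add: H_def algebra_simps idem)
    then have "X * H = X" "Y * H = Y" using X(4) Y(4) by (metis mult.assoc)+
    then show "(X - Y) * H = X - Y" by (simp add: left_diff_distrib)
    define k e where "k = max k1 k2" and "e = (1 - P) * (1 - Q)"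
    have e: "1 - P * Q - H = e" by (simp add: H_def e_def algebra_simps idem)
    have "e * b = b * e" using R(3) S(2) by (metis e_def mult.assoc)
    moreover have "a ^ k * e \<in> jacobson_radical"
      using jacobson_radical_mult_right[OF jacobson_radical_power_ge[OF k1(2), of k], of "1 - Q"]
      by (simp add: k_def e_def mult.assoc)
    moreover have "b ^ k * e \<in> jacobson_radical"
    proof -
      have "e = (1 - Q) * (1 - P)" by (simp add: e_def algebra_simps idem)
      then show ?thesis
        using jacobson_radical_mult_right[OF jacobson_radical_power_ge[OF k2(2), of k], of "1 - P"]
        by (simp add: k_def mult.assoc)
    qed
    ultimately show "(a - b) ^ (2 * k) * (1 - P * Q - H) \<in> jacobson_radical"
      using diff_power_in_jacobson_radical[OF ba, of e k "2 * k" 0 0] by (simp add: e)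
  qed
  then show "is_pDrazin_inverse (a - b)
      (v + (\<Sum>i. p * (b * p) ^ i * (1 - Q)) - (\<Sum>i. (1 - P) * (q * a) ^ i * q))"
    by (simp add: X_def Y_def Y_eq add_diff_eq)
qed

section \<open>The equivalence and the two formulas\<close>

theorem theorem3p5:
  fixes a b w :: "'a::complex_banach_algebra" and \<mu> :: complex
  assumes "\<mu> \<noteq> 0"
    and "pDrazin_invertible a"
    and "pDrazin_invertible b"
    and "a * b = \<mu> *\<^sub>C (b * a)"
    and "w = a * a\<^sup>\<ddagger> * (a - b) * b * b\<^sup>\<ddagger>"
  shows "(pDrazin_invertible (a - b) \<longleftrightarrow> pDrazin_invertible w) \<and>
    (pDrazin_invertible (a - b) \<longrightarrow>
      summable (\<lambda>i. a\<^sup>\<ddagger> * (b * a\<^sup>\<ddagger>) ^ i * b\<^sup>\<Pi>) \<and>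
      summable (\<lambda>i. a\<^sup>\<Pi> * (b\<^sup>\<ddagger> * a) ^ i * b\<^sup>\<ddagger>) \<and>
      (a - b)\<^sup>\<ddagger> = w\<^sup>\<ddagger> + (\<Sum>i. a\<^sup>\<ddagger> * (b * a\<^sup>\<ddagger>) ^ i * b\<^sup>\<Pi>)
                       - (\<Sum>i. a\<^sup>\<Pi> * (b\<^sup>\<ddagger> * a) ^ i * b\<^sup>\<ddagger>) \<and>
      w\<^sup>\<ddagger> = a * a\<^sup>\<ddagger> * (a - b)\<^sup>\<ddagger> * b * b\<^sup>\<ddagger>)"
proof -
  let ?d = "a - b" and ?P = "a * a\<^sup>\<ddagger>" and ?Q = "b * b\<^sup>\<ddagger>"
  note inv = is_pDrazin_inverse_pDrazin_inverse
  note D = diff_pDrazin_inverse[OF inv[OF assms(2)] inv[OF assms(3)] assms(4,1),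
      folded pDrazin_idempotent_def]
  \<comment> \<open>Moving \<open>?P\<close> past \<open>a - b\<close> exhibits \<open>w\<close> as
    the block of \<open>a - b\<close> in the corner of \<open>?P * ?Q\<close>.\<close>
  have w: "w = ?d * (?P * ?Q)"
  proof -
    have "w = (?P * ?d) * ?Q" using assms(5) by (simp only: mult.assoc)
    also have "\<dots> = ?d * (?P * ?Q)" using arg_cong[OF D(2), of "\<lambda>x. x * ?Q"] by (simp only: mult.assoc)
    finally show ?thesis .
  qed
  have corner: "is_pDrazin_inverse w (?d\<^sup>\<ddagger> * (?P * ?Q))" if "pDrazin_invertible ?d"
    unfolding w
  proof (rule pDrazin_corner[OF inv[OF that]])
    have "?P * ?Q * (?P * ?Q) = (?P * ?P) * (?Q * ?Q)"
      using D(1) by (metis (no_types, lifting) mult.assoc)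
    then show "?P * ?Q * (?P * ?Q) = ?P * ?Q"
      by (simp only: pDrazin_idempotent_idem[OF inv[OF assms(2)]]
          pDrazin_idempotent_idem[OF inv[OF assms(3)]])
    show "?P * ?Q * ?d = ?d * (?P * ?Q)"
      using D(2,3) by (metis (no_types, lifting) mult.assoc)
  qed
  have glue: "is_pDrazin_inverse ?d (w\<^sup>\<ddagger> + (\<Sum>i. a\<^sup>\<ddagger> * (b * a\<^sup>\<ddagger>) ^ i * b\<^sup>\<Pi>)
      - (\<Sum>i. a\<^sup>\<Pi> * (b\<^sup>\<ddagger> * a) ^ i * b\<^sup>\<ddagger>))" if "pDrazin_invertible w"
    by (rule D(6)) (use inv[OF that] in \<open>simp only: w\<close>)
  have iff: "pDrazin_invertible ?d \<longleftrightarrow> pDrazin_invertible w"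
    using corner glue by (auto simp only: pDrazin_invertible_def)
  have "w\<^sup>\<ddagger> = a * a\<^sup>\<ddagger> * ?d\<^sup>\<ddagger> * b * b\<^sup>\<ddagger>" if d: "pDrazin_invertible ?d"
  proof -
    have "w\<^sup>\<ddagger> = ?d\<^sup>\<ddagger> * ?P * ?Q"
      using pDrazin_inverse_eqI[OF corner[OF d]] by (simp only: mult.assoc)
    \<comment> \<open>The corner lemma puts both idempotents on the right; \<open>?P\<close> moves
      left because it commutes with \<open>a - b\<close>, hence with its inverse.\<close>
    also have "?d\<^sup>\<ddagger> * ?P = ?P * ?d\<^sup>\<ddagger>"
      by (rule pDrazin_double_commute[OF inv[OF d] D(2)[symmetric]])
    finally show ?thesis by (simp only: mult.assoc)
  qed
  then show ?thesis using iff D(4,5) pDrazin_inverse_eqI[OF glue] by blast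
qed

end
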